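(* The map $v_4$ from Gauss words to $\mathbb{Z}/2\mathbb{Z}$ is a finite type invariant of degree $4$ for homotopy of Gauss words.
   Context: A Gauss word is a finite word (possibly empty) in which every letter that occurs occurs exactly twice. Two Gauss words are isomorphic if a bijection of their letter sets carries one to the other letterwise. Homotopy of Gauss words is the equivalence relation generated by isomorphism and the moves (in both directions) $xAAy\leftrightarrow xy$, $xAByBAz\leftrightarrow xyz$, $xAByACzBCt\leftrightarrow xBAyCAzCBt$, where $x,y,z,t$ are arbitrary sequences of letters such that both sides are Gauss words. Finite type invariants. A homotopy invariant is a function on homotopy classes of Gauss words with values in an additive abelian group, extended linearly to the free abelian group on these classes. A Gauss word with a letter $A$ marked as a semi-letter $\dot A$ denotes $x\dot Ay\dot Az=xAyAz-xyz$, applied recursively for several semi-letters. A homotopy invariant $v$ is a finite type invariant if there is an integer $n$ such that $v$ vanishes on every Gauss word with more than $n$ semi-letters; the least such $n\ge0$ is the degree of $v$. The invariant $v_4$. For Gauss words $q,w$, a subword of $w$ here means a Gauss word obtained from $w$ by deleting a (possibly empty) set of letters (both occurrences of each), and $\langle q,w\rangle$ is the number of such subwords (counted by subsets of letters, so a word with $n$ distinct letters has $2^n$ subwords) isomorphic to $q$; it is extended linearly in $q$. Put $w_1=ABACDCBD$, $w_2=ABCACDBD$, $w_3=ABCADBDC$, $w_4=ABCBDACD$, $w_5=ABCDBDAC$, $w_6=ABCDCADB$, and $v_4(w)=\langle\sum_{i=1}^6 w_i,w\rangle \bmod 2\in\mathbb{Z}/2\mathbb{Z}$. *)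

theory Defs
  imports
    Complex_Main
    "HOL-Library.Infinite_Typeclass"
    "HOL-Library.Poly_Mapping"
    "HOL-Library.Z2"
begin

definition gauss_word :: "'a list \<Rightarrow> bool"
  where "gauss_word w \<longleftrightarrow> (\<forall>A\<in>set w. count_list w A = 2)"

definition gauss_iso :: "'a list \<Rightarrow> 'b list \<Rightarrow> bool"
  where "gauss_iso u w \<longleftrightarrow> (\<exists>f. bij_betw f (set u) (set w) \<and> map f u = w)"

text \<open>
  In \<open>move2\<close> and \<open>move3\<close> the letters \<open>A\<close>, \<open>B\<close>, \<open>C\<close> are automatically pairwise distinct and do
  not occur in \<open>x\<close>, \<open>y\<close>, \<open>z\<close>, \<open>t\<close>, since both sides are required to be Gauss words; likewise for
  the letter \<open>A\<close> of \<open>move1\<close>.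
\<close>

inductive homotopy_step :: "'a list \<Rightarrow> 'a list \<Rightarrow> bool" where
  iso: "homotopy_step u w"
    if "gauss_word u" "gauss_word w" "gauss_iso u w"
| move1: "homotopy_step (x @ [A, A] @ y) (x @ y)"
    if "gauss_word (x @ [A, A] @ y)" "gauss_word (x @ y)"
| move2: "homotopy_step (x @ [A, B] @ y @ [B, A] @ z) (x @ y @ z)"
    if "gauss_word (x @ [A, B] @ y @ [B, A] @ z)" "gauss_word (x @ y @ z)"
| move3: "homotopy_step (x @ [A, B] @ y @ [A, C] @ z @ [B, C] @ t)
                        (x @ [B, A] @ y @ [C, A] @ z @ [C, B] @ t)"
    if "gauss_word (x @ [A, B] @ y @ [A, C] @ z @ [B, C] @ t)"
       "gauss_word (x @ [B, A] @ y @ [C, A] @ z @ [C, B] @ t)"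

definition homotopic :: "'a list \<Rightarrow> 'a list \<Rightarrow> bool"
  where "homotopic u w \<longleftrightarrow> gauss_word u \<and> gauss_word w \<and> equivclp homotopy_step u w"

text \<open>
  A function on homotopy classes is represented by a function on words that is constant on
  homotopy classes of Gauss words; its values on lists that are not Gauss words are irrelevant.
\<close>

definition homotopy_invariant :: "('a list \<Rightarrow> 'g) \<Rightarrow> bool"
  where "homotopy_invariant v \<longleftrightarrow> (\<forall>u w. homotopic u w \<longrightarrow> v u = v w)"

text \<open>The multiple \<open>k\<cdot>g\<close> for an integer \<open>k\<close>: one of the two sums is always empty.\<close>

definition int_mult :: "int \<Rightarrow> 'g::ab_group_add \<Rightarrow> 'g"
  where "int_mult k g = (\<Sum>i<nat k. g) - (\<Sum>i<nat (- k). g)"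

definition linear_ext :: "('b \<Rightarrow> 'g::ab_group_add) \<Rightarrow> ('b \<Rightarrow>\<^sub>0 int) \<Rightarrow> 'g"
  where "linear_ext v c = (\<Sum>w\<in>Poly_Mapping.keys c. int_mult (Poly_Mapping.lookup c w) (v w))"

text \<open>
  \<open>semi_word As w\<close> is the element of the free abelian group denoted by the word \<open>w\<close> whose letters
  in the list \<open>As\<close> are marked as semi-letters.
\<close>

fun semi_word :: "'a list \<Rightarrow> 'a list \<Rightarrow> ('a list \<Rightarrow>\<^sub>0 int)" where
  "semi_word [] w = frag_of w"
| "semi_word (A # As) w = semi_word As w - semi_word As (removeAll A w)"

definition vanishes_above :: "('a list \<Rightarrow> 'g::ab_group_add) \<Rightarrow> nat \<Rightarrow> bool"
  where "vanishes_above v n \<longleftrightarrow>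
    (\<forall>w As. gauss_word w \<and> distinct As \<and> set As \<subseteq> set w \<and> length As > n
       \<longrightarrow> linear_ext v (semi_word As w) = 0)"

definition finite_type_invariant :: "('a list \<Rightarrow> 'g::ab_group_add) \<Rightarrow> bool"
  where "finite_type_invariant v \<longleftrightarrow> homotopy_invariant v \<and> (\<exists>n. vanishes_above v n)"

definition finite_type_degree :: "('a list \<Rightarrow> 'g::ab_group_add) \<Rightarrow> nat"
  where "finite_type_degree v = (LEAST n. vanishes_above v n)"

definition subword_count :: "'b list \<Rightarrow> 'a list \<Rightarrow> nat"
  where "subword_count q w = card {S. S \<subseteq> set w \<and> gauss_iso (filter (\<lambda>A. A \<notin> S) w) q}"

definition angle_bracket :: "('b list \<Rightarrow>\<^sub>0 int) \<Rightarrow> 'a list \<Rightarrow> int"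
  where "angle_bracket c w = linear_ext (\<lambda>q. int (subword_count q w)) c"

text \<open>The words \<open>w\<^sub>1, \<dots>, w\<^sub>6\<close>, with the letters \<open>A, B, C, D\<close> written as \<open>0, 1, 2, 3\<close>.\<close>

definition w1 :: "nat list" where "w1 = [0, 1, 0, 2, 3, 2, 1, 3]"
definition w2 :: "nat list" where "w2 = [0, 1, 2, 0, 2, 3, 1, 3]"
definition w3 :: "nat list" where "w3 = [0, 1, 2, 0, 3, 1, 3, 2]"
definition w4 :: "nat list" where "w4 = [0, 1, 2, 1, 3, 0, 2, 3]"
definition w5 :: "nat list" where "w5 = [0, 1, 2, 3, 1, 3, 0, 2]"
definition w6 :: "nat list" where "w6 = [0, 1, 2, 3, 2, 0, 3, 1]"

definition v4 :: "'a list \<Rightarrow> bit"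
  where "v4 w = of_int (angle_bracket
    (frag_of w1 + frag_of w2 + frag_of w3 + frag_of w4 + frag_of w5 + frag_of w6) w)"

end

theory Submission
  imports Defs
begin

text \<open>
  Let \<open>G u\<close> be the number, modulo 2, of the six words isomorphic to \<open>u\<close> (\<open>pattern_parity\<close> below).
  Then \<open>v\<^sub>4 w\<close> is the sum of \<open>G\<close> over the restrictions of \<open>w\<close> to all sets \<open>T\<close> of its letters
  (\<open>v4_eq_sum\<close>), and \<open>G\<close> is zero unless \<open>T\<close> has four elements. Both halves of the theorem are read
  off this formula.

  Degree. Marking a letter as a semi-letter subtracts the terms whose set \<open>T\<close> omits that letter. So
  on a word with semi-letters \<open>As\<close> only the sets \<open>T\<close> that contain all of \<open>As\<close> contribute
  (\<open>linear_ext_semi_word\<close>). With more than four semi-letters no such \<open>T\<close> has four elements. If all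
  four letters of \<open>w\<^sub>1\<close> are marked, the only term left is \<open>G w\<^sub>1 = 1\<close>.

  Invariance. For a move that involves the letters \<open>L\<close>, sort the sets \<open>T\<close> by their part outside \<open>L\<close>
  and compare the sums over the part inside \<open>L\<close>; each of these partial sums is already invariant.
  For the first move, none of the six words contains a factor \<open>AA\<close>. For the second, the terms with
  exactly one of \<open>A\<close>, \<open>B\<close> cancel in pairs, because the two restrictions are isomorphic, and none of
  the six words contains disjoint factors \<open>AB\<close> and \<open>BA\<close>. For the third, sets with at most one of
  \<open>A\<close>, \<open>B\<close>, \<open>C\<close> see no difference between the two sides. The others matter only if they have four
  elements, hence one or two letters besides \<open>A\<close>, \<open>B\<close>, \<open>C\<close>. Up to isomorphism these one or two
  letters form one of four words, cut into \<open>x, y, z, t\<close> in finitely many ways, and in each case the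
  terms of both sides add up to zero (\<open>move3_finite_check\<close>). This last fact is where the choice of
  the six words enters, and it is a computation. To make it executable, isomorphism is
  decided by comparing normal forms.
\<close>

section \<open>Linear extensions\<close>

lemma int_mult_eq_of_int_mult: "int_mult k (g :: 'g::ring_1) = of_int k * g"
  by (cases "k \<ge> 0") (auto simp: int_mult_def)

lemma linear_ext_eq_sum:
  fixes v :: "'b \<Rightarrow> 'g::ring_1"
  assumes "finite K" "Poly_Mapping.keys c \<subseteq> K"
  shows "linear_ext v c = (\<Sum>w\<in>K. of_int (Poly_Mapping.lookup c w) * v w)"
  unfolding linear_ext_def int_mult_eq_of_int_mult
  using assms by (intro sum.mono_neutral_left) (auto simp: in_keys_iff)

lemma linear_ext_frag_of: "linear_ext (v :: 'b \<Rightarrow> 'g::ring_1) (frag_of w) = v w"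
  by (simp add: linear_ext_def int_mult_eq_of_int_mult)

lemma linear_ext_add:
  "linear_ext (v :: 'b \<Rightarrow> 'g::ring_1) (c + d) = linear_ext v c + linear_ext v d"
proof -
  let ?K = "Poly_Mapping.keys c \<union> Poly_Mapping.keys d"
  have "Poly_Mapping.keys (c + d) \<subseteq> ?K" by (rule Poly_Mapping.keys_add)
  then show ?thesis
    by (simp add: linear_ext_eq_sum[of ?K] lookup_add distrib_right sum.distrib)
qed

lemma linear_ext_diff:
  "linear_ext (v :: 'b \<Rightarrow> 'g::ring_1) (c - d) = linear_ext v c - linear_ext v d"
  using linear_ext_add[of v "c - d" d] by simp

section \<open>Isomorphism of words\<close>

lemma gauss_iso_map:
  assumes "inj_on f (set u)"
  shows "gauss_iso (map f u) q \<longleftrightarrow> gauss_iso u q"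
proof
  assume "gauss_iso (map f u) q"
  then obtain g where g: "bij_betw g (f ` set u) (set q)" "map g (map f u) = q"
    by (auto simp: gauss_iso_def)
  have "bij_betw (g \<circ> f) (set u) (set q)"
    using assms g(1) by (intro bij_betw_trans[of f "set u" "f ` set u"]) (auto simp: bij_betw_def)
  with g(2) show "gauss_iso u q" by (auto simp: gauss_iso_def)
next
  assume "gauss_iso u q"
  then obtain g where g: "bij_betw g (set u) (set q)" "map g u = q"
    by (auto simp: gauss_iso_def)
  let ?h = "g \<circ> inv_into (set u) f"
  have "bij_betw ?h (f ` set u) (set q)"
    using assms g(1) by (intro bij_betw_trans[of "inv_into (set u) f" _ "set u"])
      (auto intro: bij_betw_inv_into simp: bij_betw_def inj_on_inv_into)
  moreover have "map ?h (map f u) = q"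
    using assms g(2) by (auto simp: inv_into_f_f)
  ultimately show "gauss_iso (map f u) q" unfolding gauss_iso_def by auto
qed

lemma gauss_iso_lengthD: "gauss_iso u q \<Longrightarrow> length u = length q"
  by (auto simp: gauss_iso_def)

lemma gauss_iso_nth_eqD:
  assumes "gauss_iso u q" "u ! i = u ! j" "i < length u" "j < length u"
  shows "q ! i = q ! j"
  using assms by (auto simp: gauss_iso_def)

text \<open>
  Each letter is replaced by the position of its first occurrence. This is a complete invariant of
  isomorphism, and unlike \<open>gauss_iso\<close> it can be computed.
\<close>

definition normal_form :: "'a list \<Rightarrow> nat list"
  where "normal_form u = map (\<lambda>a. length (takeWhile (\<lambda>b. b \<noteq> a) u)) u"

lemma length_normal_form [simp]: "length (normal_form u) = length u"
  by (simp add: normal_form_def)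

lemma length_takeWhile_less_if_mem: "a \<in> set u \<Longrightarrow> length (takeWhile (\<lambda>b. b \<noteq> a) u) < length u"
  by (induction u) auto

lemma nth_length_takeWhile_mem: "a \<in> set u \<Longrightarrow> u ! length (takeWhile (\<lambda>b. b \<noteq> a) u) = a"
  using nth_length_takeWhile[OF length_takeWhile_less_if_mem] by fastforce

lemma nth_normal_form:
  assumes "i < length u"
  shows "u ! (normal_form u ! i) = u ! i"
  using assms by (simp add: normal_form_def nth_length_takeWhile_mem)

lemma normal_form_nth_eq_iff:
  assumes "i < length u" "j < length u"
  shows "normal_form u ! i = normal_form u ! j \<longleftrightarrow> u ! i = u ! j"
  using assms by (metis nth_normal_form normal_form_def nth_map)

lemma gauss_iso_iff_normal_form: "gauss_iso u q \<longleftrightarrow> normal_form u = normal_form q"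
proof
  assume "gauss_iso u q"
  then obtain f where f: "inj_on f (set u)" "q = map f u"
    by (auto simp: gauss_iso_def bij_betw_def)
  have "takeWhile (\<lambda>b. f b \<noteq> f a) u = takeWhile (\<lambda>b. b \<noteq> a) u" if "a \<in> set u" for a
    using f(1) that by (intro takeWhile_cong) (auto dest: inj_onD)
  then show "normal_form u = normal_form q"
    by (auto simp: normal_form_def f(2) takeWhile_map o_def)
next
  assume eq: "normal_form u = normal_form q"
  have len: "length u = length q" using arg_cong[OF eq, of length] by simp
  \<comment> \<open>The isomorphism sends a letter of \<open>u\<close> to the letter of \<open>q\<close> at the place where it first occurs.\<close>
  define f where "f a = q ! length (takeWhile (\<lambda>b. b \<noteq> a) u)" for a
  have f_nth: "f (u ! i) = q ! i" if "i < length u" for i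
  proof -
    have "f (u ! i) = q ! (normal_form u ! i)" using that by (simp add: f_def normal_form_def)
    then show ?thesis using that eq len nth_normal_form[of i q] by simp
  qed
  have "map f u = q" using len f_nth by (auto intro: nth_equalityI)
  moreover have "inj_on f (set u)"
  proof (rule inj_onI)
    fix a b assume "a \<in> set u" "b \<in> set u" and fab: "f a = f b"
    then obtain i j where ij: "i < length u" "j < length u" "a = u ! i" "b = u ! j"
      by (metis in_set_conv_nth)
    then have "q ! i = q ! j" using fab f_nth by simp
    then show "a = b" using ij eq len by (metis normal_form_nth_eq_iff)
  qed
  ultimately show "gauss_iso u q" by (auto simp: gauss_iso_def bij_betw_def)
qed

section \<open>The invariant as a sum over sets of letters\<close>

abbreviation restrict_word :: "'a list \<Rightarrow> 'a set \<Rightarrow> 'a list"  (infixl "\<downharpoonright>" 90)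
  where "w \<downharpoonright> T \<equiv> filter (\<lambda>A. A \<in> T) w"

lemma filter_eq_or_notin [simp]:
  "A \<notin> set w \<Longrightarrow> filter (\<lambda>B. B = A \<or> P B) w = filter P w"
  by (auto intro: filter_cong)

definition patterns :: "nat list list"
  where "patterns = [w1, w2, w3, w4, w5, w6]"

definition pattern_parity :: "'a list \<Rightarrow> bit"
  where "pattern_parity u = (\<Sum>q\<leftarrow>patterns. of_bool (gauss_iso u q))"

lemmas patterns_defs = patterns_def w1_def w2_def w3_def w4_def w5_def w6_def

lemma patterns_length: "q \<in> set patterns \<Longrightarrow> length q = 8"
  by (auto simp: patterns_defs)

lemma pattern_parity_eq_0I:
  assumes "\<And>q. q \<in> set patterns \<Longrightarrow> \<not> gauss_iso u q"
  shows "pattern_parity u = 0"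
  using assms by (simp add: pattern_parity_def patterns_def)

lemma pattern_parity_eq_0_if_length: "length u \<noteq> 8 \<Longrightarrow> pattern_parity u = 0"
  by (intro pattern_parity_eq_0I) (auto dest!: gauss_iso_lengthD patterns_length)

lemma pattern_parity_map: "inj_on f (set u) \<Longrightarrow> pattern_parity (map f u) = pattern_parity u"
  by (simp add: pattern_parity_def gauss_iso_map)

lemma subword_count_eq_sum:
  "of_nat (subword_count q w) = (\<Sum>T\<in>Pow (set w). of_bool (gauss_iso (w \<downharpoonright> T) q) :: 'r::semiring_1)"
proof -
  have "bij_betw (\<lambda>S. set w - S) {S. S \<subseteq> set w \<and> gauss_iso (filter (\<lambda>A. A \<notin> S) w) q}
          {T \<in> Pow (set w). gauss_iso (w \<downharpoonright> T) q}"
  proof (rule bij_betw_byWitness[where f' = "\<lambda>T. set w - T"])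
    have "w \<downharpoonright> (set w - S) = filter (\<lambda>A. A \<notin> S) w" for S
      by (auto intro: filter_cong)
    moreover have "filter (\<lambda>A. A \<notin> set w - S) w = w \<downharpoonright> S" for S
      by (auto intro: filter_cong)
    ultimately
    show "(-) (set w) ` {S. S \<subseteq> set w \<and> gauss_iso (filter (\<lambda>A. A \<notin> S) w) q}
            \<subseteq> {T \<in> Pow (set w). gauss_iso (w \<downharpoonright> T) q}"
      and "(-) (set w) ` {T \<in> Pow (set w). gauss_iso (w \<downharpoonright> T) q}
            \<subseteq> {S. S \<subseteq> set w \<and> gauss_iso (filter (\<lambda>A. A \<notin> S) w) q}"
      by auto
  qed auto
  then have "subword_count q w = card {T \<in> Pow (set w). gauss_iso (w \<downharpoonright> T) q}"
    unfolding subword_count_def by (rule bij_betw_same_card)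
  then show ?thesis
    by (simp add: Int_def)
qed

lemma v4_eq_sum: "v4 w = (\<Sum>T\<in>Pow (set w). pattern_parity (w \<downharpoonright> T))"
proof -
  have "v4 w = (\<Sum>q\<leftarrow>patterns. of_nat (subword_count q w))"
    by (simp add: v4_def angle_bracket_def linear_ext_add linear_ext_frag_of patterns_def add.assoc)
  also have "\<dots> = (\<Sum>T\<in>Pow (set w). pattern_parity (w \<downharpoonright> T))"
    unfolding subword_count_eq_sum
    by (simp only: pattern_parity_def patterns_def list.map sum_list.Cons sum_list.Nil
        sum.distrib sum.neutral_const)
  finally show ?thesis .
qed

lemma sum_Pow_insert:
  assumes "finite R" "a \<notin> R"
  shows "(\<Sum>T\<in>Pow (insert a R). f T) = (\<Sum>T\<in>Pow R. f T + f (insert a T))"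
proof -
  have "inj_on (insert a) (Pow R)" using assms(2) by (auto simp: inj_on_def)
  moreover have "Pow R \<inter> insert a ` Pow R = {}" using assms(2) by auto
  ultimately show ?thesis
    using assms(1) by (simp add: Pow_insert sum.union_disjoint sum.reindex sum.distrib)
qed

lemma sum_Pow_insert2:
  assumes "finite R" "a \<notin> R" "b \<notin> R" "a \<noteq> b"
  shows "(\<Sum>T\<in>Pow (insert a (insert b R)). f T) =
    (\<Sum>T\<in>Pow R. f T + f (insert a T) + f (insert b T) + f (insert a (insert b T)))"
  using assms by (simp add: sum_Pow_insert add.assoc)

lemma sum_Pow_insert3:
  assumes "finite R" "a \<notin> R" "b \<notin> R" "c \<notin> R" "distinct [a, b, c]"
  shows "(\<Sum>T\<in>Pow (insert a (insert b (insert c R))). f T) =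
    (\<Sum>T\<in>Pow R. f T + f (insert a T) + f (insert b T) + f (insert c T)
      + (f (insert a (insert b T)) + f (insert a (insert c T)) + f (insert b (insert c T))
        + f (insert a (insert b (insert c T)))))"
proof -
  have "(\<Sum>T\<in>Pow (insert a (insert b (insert c R))). f T) =
    (\<Sum>T\<in>Pow R. f T + f (insert a T) + f (insert b T) + f (insert a (insert b T))
      + (f (insert c T) + f (insert a (insert c T)) + f (insert b (insert c T))
        + f (insert a (insert b (insert c T)))))"
    using assms by (subst sum_Pow_insert2, simp_all) (subst sum_Pow_insert, simp_all)
  then show ?thesis by (simp only: ac_simps)
qed

section \<open>Semi-letters\<close>

text \<open>
  Inclusion-exclusion: deleting \<open>A\<close> from \<open>w\<close> keeps exactly the terms with \<open>A \<notin> T\<close>, so the difference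
  that defines the semi-letter \<open>A\<close> keeps exactly those with \<open>A \<in> T\<close>. The argument applies to every
  function that counts subwords with weights.
\<close>

lemma linear_ext_semi_word:
  fixes g :: "'a list \<Rightarrow> 'g::ring_1"
  assumes v: "\<And>w. v w = (\<Sum>T\<in>Pow (set w). g (w \<downharpoonright> T))"
    and "distinct As" "set As \<subseteq> set w"
  shows "linear_ext v (semi_word As w) = (\<Sum>T | set As \<subseteq> T \<and> T \<subseteq> set w. g (w \<downharpoonright> T))"
  using assms(2,3)
proof (induction As arbitrary: w)
  case Nil
  then show ?case by (simp add: linear_ext_frag_of v Pow_def)
next
  case (Cons A As)
  let ?w' = "removeAll A w"
  have restrict: "?w' \<downharpoonright> T = w \<downharpoonright> T" if "A \<notin> T" for T
    using that by (auto simp: removeAll_filter_not_eq intro: filter_cong)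
  have "linear_ext v (semi_word (A # As) w) =
      (\<Sum>T | set As \<subseteq> T \<and> T \<subseteq> set w. g (w \<downharpoonright> T)) - (\<Sum>T | set As \<subseteq> T \<and> T \<subseteq> set ?w'. g (?w' \<downharpoonright> T))"
    using Cons.prems by (simp add: linear_ext_diff Cons.IH subset_Diff_insert)
  also have "(\<Sum>T | set As \<subseteq> T \<and> T \<subseteq> set ?w'. g (?w' \<downharpoonright> T)) =
      (\<Sum>T | set As \<subseteq> T \<and> T \<subseteq> set ?w'. g (w \<downharpoonright> T))"
    by (intro sum.cong refl arg_cong[where f = g] restrict) auto
  also have "(\<Sum>T | set As \<subseteq> T \<and> T \<subseteq> set w. g (w \<downharpoonright> T)) - \<dots> =
      sum (\<lambda>T. g (w \<downharpoonright> T)) ({T. set As \<subseteq> T \<and> T \<subseteq> set w} - {T. set As \<subseteq> T \<and> T \<subseteq> set ?w'})"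
    by (rule sum_diff[symmetric]) (auto intro: finite_subset[of _ "Pow (set w)"])
  also have "{T. set As \<subseteq> T \<and> T \<subseteq> set w} - {T. set As \<subseteq> T \<and> T \<subseteq> set ?w'} =
      {T. set (A # As) \<subseteq> T \<and> T \<subseteq> set w}"
    by auto
  finally show ?case .
qed

lemma count_list_filter: "P A \<Longrightarrow> count_list (filter P w) A = count_list w A"
  by (induction w) auto

lemma gauss_word_filter: "gauss_word w \<Longrightarrow> gauss_word (filter P w)"
  by (simp add: gauss_word_def count_list_filter)

lemma gauss_word_length: "gauss_word w \<Longrightarrow> length w = 2 * card (set w)"
  using sum_count_set[of w "set w"] by (simp add: gauss_word_def)

text \<open>
  A set containing more than four letters restricts \<open>w\<close> to a word of length more than eight.
\<close>

lemma vanishes_above_v4: "vanishes_above v4 4"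
  unfolding vanishes_above_def
proof (intro allI impI, elim conjE)
  fix w As :: "'a list"
  assume w: "gauss_word w" and As: "distinct As" "set As \<subseteq> set w" "length As > 4"
  have "pattern_parity (w \<downharpoonright> T) = 0" if "set As \<subseteq> T" "T \<subseteq> set w" for T
  proof (rule pattern_parity_eq_0_if_length)
    have "length (w \<downharpoonright> T) = 2 * card T"
      using gauss_word_length[OF gauss_word_filter[OF w, of "\<lambda>A. A \<in> T"]] that(2)
      by (simp add: Collect_conj_eq Int_absorb1)
    moreover have "length As \<le> card T"
      using that As(1) by (metis card_mono distinct_card finite_set rev_finite_subset)
    ultimately show "length (w \<downharpoonright> T) \<noteq> 8" using As(3) by simp
  qed
  then show "linear_ext v4 (semi_word As w) = 0"
    using As by (simp add: linear_ext_semi_word[OF v4_eq_sum])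
qed

text \<open>
  The witness is a copy of \<open>w\<^sub>1\<close> with all four letters marked; since the set \<open>T\<close> of all letters is
  then the only one to contribute, the value is \<open>G w\<^sub>1 = 1\<close>. The alphabet must be large enough to
  contain the copy.
\<close>

lemma not_vanishes_above_v4:
  assumes "n < 4"
  shows "\<not> vanishes_above (v4 :: 'a::infinite list \<Rightarrow> bit) n"
proof
  assume van: "vanishes_above (v4 :: 'a list \<Rightarrow> bit) n"
  obtain f :: "nat \<Rightarrow> 'a" where f: "inj f"
    using infinite_countable_subset[OF infinite_UNIV] by blast
  define w where "w = map f w1"
  define As where "As = map f [0, 1, 2, 3]"
  have As: "distinct As" "set As = set w" "length As = 4"
    using f by (auto simp: As_def w_def w1_def inj_eq)
  have "gauss_word w"
    using f by (auto simp: gauss_word_def w_def w1_def inj_eq)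
  then have "linear_ext v4 (semi_word As w) = 0"
    using van As assms by (auto simp: vanishes_above_def)
  moreover have "linear_ext v4 (semi_word As w) = pattern_parity w"
  proof -
    have "{T. set As \<subseteq> T \<and> T \<subseteq> set w} = {set w}" using As(2) by auto
    then show ?thesis using As by (simp add: linear_ext_semi_word[OF v4_eq_sum])
  qed
  moreover have "pattern_parity w = pattern_parity w1"
    unfolding w_def using f by (intro pattern_parity_map) (auto intro: inj_on_subset)
  moreover have "map (\<lambda>q. gauss_iso w1 q) patterns = [True, False, False, False, False, False]"
    unfolding gauss_iso_iff_normal_form by code_simp
  then have "pattern_parity w1 = 1" by (simp add: pattern_parity_def patterns_def)
  ultimately show False by simp
qed

section \<open>Invariance under isomorphism and the first two moves\<close>

lemma v4_gauss_iso:
  assumes "gauss_iso u w"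
  shows "v4 u = v4 w"
proof -
  obtain f where inj: "inj_on f (set u)" and w: "w = map f u"
    using assms by (auto simp: gauss_iso_def bij_betw_def)
  have "v4 w = (\<Sum>T\<in>image f ` Pow (set u). pattern_parity (map f u \<downharpoonright> T))"
    by (simp add: v4_eq_sum w image_Pow_surj)
  also have "\<dots> = (\<Sum>T\<in>Pow (set u). pattern_parity (map f u \<downharpoonright> (f ` T)))"
    using inj by (subst sum.reindex) (auto intro: inj_on_image_Pow)
  also have "\<dots> = (\<Sum>T\<in>Pow (set u). pattern_parity (u \<downharpoonright> T))"
  proof (rule sum.cong[OF refl])
    fix T assume T: "T \<in> Pow (set u)"
    have "f A \<in> f ` T \<longleftrightarrow> A \<in> T" if "A \<in> set u" for A
      using inj T that by (simp add: inj_on_image_mem_iff)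
    then have "map f u \<downharpoonright> (f ` T) = map f (u \<downharpoonright> T)"
      by (simp add: filter_map o_def cong: filter_cong)
    moreover have "inj_on f (set (u \<downharpoonright> T))" using inj by (rule inj_on_subset) auto
    ultimately show "pattern_parity (map f u \<downharpoonright> (f ` T)) = pattern_parity (u \<downharpoonright> T)"
      by (simp only: pattern_parity_map)
  qed
  finally show ?thesis by (simp add: v4_eq_sum)
qed

lemma pattern_parity_adjacent: "pattern_parity (x @ [A, A] @ y) = 0"
proof (rule pattern_parity_eq_0I, rule notI)
  fix q assume q: "q \<in> set patterns" and iso: "gauss_iso (x @ [A, A] @ y) q"
  have "q ! length x = q ! Suc (length x)"
    using iso by (rule gauss_iso_nth_eqD) (auto simp: nth_append)
  moreover have "length x < 7"
    using gauss_iso_lengthD[OF iso] patterns_length[OF q] by simp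
  moreover have "\<forall>q\<in>set patterns. \<forall>i\<in>set [0..<7]. q ! i \<noteq> q ! Suc i" by code_simp
  ultimately show False using q by auto
qed

text \<open>
  In the six words, two factors \<open>AB\<close> and \<open>BA\<close> can only overlap, as in \<open>CDC\<close>.
\<close>

lemma pattern_parity_opposite: "pattern_parity (x @ [A, B] @ y @ [B, A] @ z) = 0"
proof (rule pattern_parity_eq_0I, rule notI)
  let ?u = "x @ [A, B] @ y @ [B, A] @ z" and ?j = "length x + 2 + length y"
  fix q assume q: "q \<in> set patterns" and iso: "gauss_iso ?u q"
  have "q ! length x = q ! Suc ?j" "q ! Suc (length x) = q ! ?j"
    by (rule gauss_iso_nth_eqD[OF iso]; auto simp: nth_append)+
  moreover have "?j < 7"
    using gauss_iso_lengthD[OF iso] patterns_length[OF q] by simp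
  moreover have "\<forall>q\<in>set patterns. \<forall>j\<in>set [0..<7]. \<forall>i\<in>set [0..<j].
      Suc i < j \<longrightarrow> \<not> (q ! i = q ! Suc j \<and> q ! Suc i = q ! j)"
    by code_simp
  ultimately show False using q by auto
qed

lemma gauss_word_appendD:
  assumes "gauss_word (x @ u @ y)" "A \<in> set u" "count_list u A \<ge> 2"
  shows "A \<notin> set x" "A \<notin> set y"
proof -
  have "count_list (x @ u @ y) A = 2" using assms(1,2) by (simp add: gauss_word_def)
  then show "A \<notin> set x" "A \<notin> set y" using assms(3) by (auto simp: count_list_0_iff[symmetric])
qed

lemma v4_move1:
  assumes "gauss_word (x @ [A, A] @ y)"
  shows "v4 (x @ [A, A] @ y) = v4 (x @ y)"
proof -
  have A: "A \<notin> set x" "A \<notin> set y"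
    using gauss_word_appendD[OF assms, of A] by auto
  have "v4 (x @ [A, A] @ y) =
    (\<Sum>T\<in>Pow (insert A (set (x @ y))). pattern_parity ((x @ [A, A] @ y) \<downharpoonright> T))"
    by (simp add: v4_eq_sum)
  also have "\<dots> = (\<Sum>T\<in>Pow (set (x @ y)). pattern_parity ((x @ y) \<downharpoonright> T))"
  proof (subst sum_Pow_insert)
    show "(\<Sum>T\<in>Pow (set (x @ y)). pattern_parity ((x @ [A, A] @ y) \<downharpoonright> T)
        + pattern_parity ((x @ [A, A] @ y) \<downharpoonright> insert A T)) =
      (\<Sum>T\<in>Pow (set (x @ y)). pattern_parity ((x @ y) \<downharpoonright> T))"
    proof (rule sum.cong[OF refl])
      fix T assume "T \<in> Pow (set (x @ y))"
      then have "A \<notin> T" using A by auto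
      then show "pattern_parity ((x @ [A, A] @ y) \<downharpoonright> T)
          + pattern_parity ((x @ [A, A] @ y) \<downharpoonright> insert A T) = pattern_parity ((x @ y) \<downharpoonright> T)"
        using A pattern_parity_adjacent[of "x \<downharpoonright> T" A "y \<downharpoonright> T"] by simp
    qed
  qed (use A in auto)
  finally show ?thesis by (simp add: v4_eq_sum)
qed

text \<open>
  In the sum over the part of \<open>T\<close> inside \<open>{A, B}\<close>, the terms for \<open>{A}\<close> and \<open>{B}\<close> agree after renaming
  \<open>A\<close> to \<open>B\<close> and cancel modulo 2, and the term for \<open>{A, B}\<close> is zero.
\<close>

lemma v4_move2:
  assumes "gauss_word (x @ [A, B] @ y @ [B, A] @ z)"
  shows "v4 (x @ [A, B] @ y @ [B, A] @ z) = v4 (x @ y @ z)"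
proof -
  let ?w = "x @ [A, B] @ y @ [B, A] @ z" and ?R = "set (x @ y @ z)"
  have "count_list ?w A = 2" "count_list ?w B = 2"
    using assms by (auto simp only: gauss_word_def set_append list.set Un_iff insert_iff)
  then have "A \<noteq> B" and A: "A \<notin> set x" "A \<notin> set y" "A \<notin> set z"
    and B: "B \<notin> set x" "B \<notin> set y" "B \<notin> set z"
    by (auto simp flip: count_list_0_iff split: if_splits)
  have "set ?w = insert A (insert B ?R)" by auto
  then have "v4 ?w = (\<Sum>T\<in>Pow (insert A (insert B ?R)). pattern_parity (?w \<downharpoonright> T))"
    by (simp only: v4_eq_sum)
  also have "\<dots> = (\<Sum>T\<in>Pow ?R. pattern_parity (?w \<downharpoonright> T) + pattern_parity (?w \<downharpoonright> insert A T)
      + pattern_parity (?w \<downharpoonright> insert B T) + pattern_parity (?w \<downharpoonright> insert A (insert B T)))"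
    using \<open>A \<noteq> B\<close> A B by (intro sum_Pow_insert2) auto
  also have "\<dots> = (\<Sum>T\<in>Pow ?R. pattern_parity ((x @ y @ z) \<downharpoonright> T))"
  proof (rule sum.cong[OF refl])
    fix T assume "T \<in> Pow ?R"
    then have T: "A \<notin> T" "B \<notin> T" using A B by auto
    let ?x = "x \<downharpoonright> T" and ?y = "y \<downharpoonright> T" and ?z = "z \<downharpoonright> T"
    have "pattern_parity (map (id(A := B)) (?x @ [A] @ ?y @ [A] @ ?z)) =
        pattern_parity (?x @ [A] @ ?y @ [A] @ ?z)"
      using B by (intro pattern_parity_map) (auto simp: inj_on_def)
    moreover have "map (id(A := B)) (?x @ [A] @ ?y @ [A] @ ?z) = ?x @ [B] @ ?y @ [B] @ ?z"
      using T by (auto intro: map_idI)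
    ultimately have swap: "pattern_parity (?x @ [B] @ ?y @ [B] @ ?z) =
        pattern_parity (?x @ [A] @ ?y @ [A] @ ?z)"
      by (simp only:)
    have cancel: "a + b + b + 0 = a" for a b :: bit by (cases b) auto
    have "?w \<downharpoonright> T = (x @ y @ z) \<downharpoonright> T" "?w \<downharpoonright> insert A T = ?x @ [A] @ ?y @ [A] @ ?z"
      "?w \<downharpoonright> insert B T = ?x @ [B] @ ?y @ [B] @ ?z"
      "?w \<downharpoonright> insert A (insert B T) = ?x @ [A, B] @ ?y @ [B, A] @ ?z"
      using \<open>A \<noteq> B\<close> A B T by (auto intro!: filter_cong)
    then show "pattern_parity (?w \<downharpoonright> T) + pattern_parity (?w \<downharpoonright> insert A T)
        + pattern_parity (?w \<downharpoonright> insert B T) + pattern_parity (?w \<downharpoonright> insert A (insert B T))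
        = pattern_parity ((x @ y @ z) \<downharpoonright> T)"
      by (simp only: pattern_parity_opposite swap cancel)
  qed
  finally show ?thesis by (simp only: v4_eq_sum)
qed

section \<open>Invariance under the third move\<close>

lemma map_normal_form_patterns:
  "map normal_form patterns =
    [[0, 1, 0, 3, 4, 3, 1, 4], [0, 1, 2, 0, 2, 5, 1, 5], [0, 1, 2, 0, 4, 1, 4, 2],
     [0, 1, 2, 1, 4, 0, 2, 4], [0, 1, 2, 3, 1, 3, 0, 2], [0, 1, 2, 3, 2, 0, 3, 1]]"
  by code_simp

definition is_pattern_form :: "nat list \<Rightarrow> bool"
  where "is_pattern_form n \<longleftrightarrow> n \<in> set
    [[0, 1, 0, 3, 4, 3, 1, 4], [0, 1, 2, 0, 2, 5, 1, 5], [0, 1, 2, 0, 4, 1, 4, 2],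
     [0, 1, 2, 1, 4, 0, 2, 4], [0, 1, 2, 3, 1, 3, 0, 2], [0, 1, 2, 3, 2, 0, 3, 1]]"

lemma pattern_parity_eq_of_bool: "pattern_parity u = of_bool (is_pattern_form (normal_form u))"
proof -
  have "pattern_parity u = (\<Sum>n\<leftarrow>map normal_form patterns. of_bool (normal_form u = n))"
    by (simp add: pattern_parity_def gauss_iso_iff_normal_form o_def)
  then show ?thesis
    unfolding map_normal_form_patterns is_pattern_form_def by auto
qed

text \<open>
  The restrictions of the two sides of the third move that keep at least two of \<open>A\<close>, \<open>B\<close>, \<open>C\<close>, where
  \<open>x, y, z, t\<close> are already restricted. Restrictions that keep fewer are the same on both sides.
\<close>

definition move3_subwords ::
    "'a \<Rightarrow> 'a \<Rightarrow> 'a \<Rightarrow> 'a list \<Rightarrow> 'a list \<Rightarrow> 'a list \<Rightarrow> 'a list \<Rightarrow> 'a list list"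
  where "move3_subwords A B C x y z t =
    [x @ [A, B] @ y @ [A] @ z @ [B] @ t, x @ [B, A] @ y @ [A] @ z @ [B] @ t,
     x @ [A] @ y @ [A, C] @ z @ [C] @ t, x @ [A] @ y @ [C, A] @ z @ [C] @ t,
     x @ [B] @ y @ [C] @ z @ [B, C] @ t, x @ [B] @ y @ [C] @ z @ [C, B] @ t,
     x @ [A, B] @ y @ [A, C] @ z @ [B, C] @ t, x @ [B, A] @ y @ [C, A] @ z @ [C, B] @ t]"

lemma map_move3_subwords:
  "map (map f) (move3_subwords A B C x y z t) =
    move3_subwords (f A) (f B) (f C) (map f x) (map f y) (map f z) (map f t)"
  by (simp add: move3_subwords_def)

lemma set_move3_subwords:
  "w \<in> set (move3_subwords A B C x y z t) \<Longrightarrow> set w \<subseteq> {A, B, C} \<union> set (x @ y @ z @ t)"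
  by (auto simp: move3_subwords_def)

definition cuts :: "'a list \<Rightarrow> ('a list \<times> 'a list) list"
  where "cuts u = map (\<lambda>i. (take i u, drop i u)) [0..<Suc (length u)]"

lemma append_in_cuts: "(x, y) \<in> set (cuts (x @ y))"
  by (auto simp: cuts_def image_iff intro!: bexI[of _ "length x"])

text \<open>
  The computation behind the third move: 0, 1, 2 stand for \<open>A\<close>, \<open>B\<close>, \<open>C\<close>, and the concatenation of
  \<open>x, y, z, t\<close> runs over the Gauss words with one or two letters 3 and 4 that start with 3. With one
  further letter only the two restrictions keeping all of \<open>A\<close>, \<open>B\<close>, \<open>C\<close> have length eight, with two
  further letters only the six restrictions keeping a pair do. The six do not cancel
  pair by pair; only their total is even.
\<close>

lemma move3_finite_check:
  "\<forall>u\<in>set [[3::nat, 3], [3, 3, 4, 4], [3, 4, 3, 4], [3, 4, 4, 3]].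
    \<forall>(x, r)\<in>set (cuts u). \<forall>(y, s)\<in>set (cuts r). \<forall>(z, t)\<in>set (cuts s).
      even (length (filter (\<lambda>w. is_pattern_form (normal_form w)) (move3_subwords 0 1 2 x y z t)))"
  by code_simp

lemma even_pattern_forms_move3_subwords:
  assumes "x @ y @ z @ t \<in> set [[3::nat, 3], [3, 3, 4, 4], [3, 4, 3, 4], [3, 4, 4, 3]]"
  shows "even (length (filter (\<lambda>w. is_pattern_form (normal_form w)) (move3_subwords 0 1 2 x y z t)))"
  using move3_finite_check[THEN bspec, OF assms, THEN bspec, OF append_in_cuts, unfolded prod.case,
      THEN bspec, OF append_in_cuts, unfolded prod.case, THEN bspec, OF append_in_cuts] by simp

lemma sum_list_of_bool: "(\<Sum>w\<leftarrow>ws. of_bool (P w) :: 'r::semiring_1) = of_nat (length (filter P ws))"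
  by (induction ws) auto

lemma gauss_words_on_two_letters:
  fixes u :: "nat list"
  assumes "gauss_word u" "set u \<subseteq> {3, 4}" "hd u = 3" "length u = 2 \<or> length u = 4"
  shows "u \<in> set [[3, 3], [3, 3, 4, 4], [3, 4, 3, 4], [3, 4, 4, 3]]"
  using assms(4)
proof
  assume "length u = 2"
  then obtain a b where "u = [a, b]" by (auto simp: length_Suc_conv numeral_2_eq_2)
  then show ?thesis using assms by (auto simp: gauss_word_def)
next
  assume "length u = 4"
  then obtain a b c d where "u = [a, b, c, d]" by (auto simp: length_Suc_conv eval_nat_numeral)
  then show ?thesis using assms by (auto simp: gauss_word_def)
qed

lemma gauss_word_map:
  assumes "inj_on f (set w)" "gauss_word w"
  shows "gauss_word (map f w)"
proof -
  have "count_list (map f w) (f A) = count_list w A" if "A \<in> set w" for A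
    using assms(1) that by (rule count_list_inj_map)
  then show ?thesis using assms(2) by (auto simp: gauss_word_def)
qed

text \<open>
  Renaming letters reduces this to \<open>move3_finite_check\<close>. If the remaining letters are neither one nor
  two in number, all eight words have a length different from eight.
\<close>

lemma sum_pattern_parity_move3_subwords:
  assumes u: "gauss_word (x @ y @ z @ t)" (is "gauss_word ?u")
    and dist: "distinct [A, B, C]" and notin: "{A, B, C} \<inter> set (x @ y @ z @ t) = {}"
  shows "(\<Sum>w\<leftarrow>move3_subwords A B C x y z t. pattern_parity w) = 0"
proof (cases "length ?u = 2 \<or> length ?u = 4")
  case False
  then show ?thesis
    by (simp add: move3_subwords_def pattern_parity_eq_0_if_length)
next
  case True
  define D where "D = hd ?u"
  \<comment> \<open>The letters besides \<open>A\<close>, \<open>B\<close>, \<open>C\<close> are named in the order of their occurrence.\<close>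
  define f :: "'a \<Rightarrow> nat" where
    "f a = (if a = A then 0 else if a = B then 1 else if a = C then 2 else if a = D then 3 else 4)" for a
  have D: "D \<in> set ?u" unfolding D_def using True by (intro hd_in_set) auto
  have "card (set ?u) \<le> 2" using gauss_word_length[OF u] True by linarith
  then have "card (set ?u - {D}) \<le> 1" using D by (simp add: card_Diff_singleton)
  then have "a = b" if "a \<in> set ?u - {D}" "b \<in> set ?u - {D}" for a b
    using that by (metis One_nat_def card_le_Suc0_iff_eq finite_Diff finite_set)
  then have inj: "inj_on f ({A, B, C} \<union> set ?u)"
    using dist notin unfolding inj_on_def f_def by auto
  have "map f ?u \<in> set [[3, 3], [3, 3, 4, 4], [3, 4, 3, 4], [3, 4, 4, 3]]"
  proof (rule gauss_words_on_two_letters)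
    show "gauss_word (map f ?u)" using inj u by (intro gauss_word_map) (auto intro: inj_on_subset)
    show "set (map f ?u) \<subseteq> {3, 4}" using notin by (auto simp: f_def)
    have "f D = 3" using D notin by (auto simp: f_def)
    then show "hd (map f ?u) = 3" using True by (subst hd_map) (auto simp: D_def)
    show "length (map f ?u) = 2 \<or> length (map f ?u) = 4" using True by simp
  qed
  then have even: "even (length (filter (\<lambda>w. is_pattern_form (normal_form w))
      (move3_subwords 0 1 2 (map f x) (map f y) (map f z) (map f t))))"
    unfolding map_append by (rule even_pattern_forms_move3_subwords)
  have "(\<Sum>w\<leftarrow>move3_subwords A B C x y z t. pattern_parity w) =
      (\<Sum>w\<leftarrow>move3_subwords A B C x y z t. pattern_parity (map f w))"
    by (intro arg_cong[where f = sum_list] map_cong refl pattern_parity_map[symmetric]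
        inj_on_subset[OF inj] set_move3_subwords)
  also have "\<dots> = (\<Sum>w\<leftarrow>map (map f) (move3_subwords A B C x y z t). pattern_parity w)"
    by (simp add: o_def)
  also have "map (map f) (move3_subwords A B C x y z t) =
      move3_subwords 0 1 2 (map f x) (map f y) (map f z) (map f t)"
    using dist by (auto simp: map_move3_subwords f_def)
  also have "(\<Sum>w\<leftarrow>\<dots>. pattern_parity w) = 0"
    unfolding pattern_parity_eq_of_bool sum_list_of_bool using even by (auto elim!: evenE)
  finally show ?thesis .
qed

text \<open>
  The sum over the part of \<open>T\<close> inside \<open>{A, B, C}\<close> splits into the terms keeping at most one of these
  letters, which are the same for both sides, and the terms keeping at least two, whose totals
  agree by the finite check.
\<close>

lemma v4_move3:
  assumes gauss: "gauss_word (x @ [A, B] @ y @ [A, C] @ z @ [B, C] @ t)"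
  shows "v4 (x @ [A, B] @ y @ [A, C] @ z @ [B, C] @ t) =
    v4 (x @ [B, A] @ y @ [C, A] @ z @ [C, B] @ t)"
proof -
  let ?l = "x @ [A, B] @ y @ [A, C] @ z @ [B, C] @ t"
  let ?r = "x @ [B, A] @ y @ [C, A] @ z @ [C, B] @ t"
  let ?R = "set (x @ y @ z @ t)"
  have "count_list ?l A = 2" "count_list ?l B = 2" "count_list ?l C = 2"
    using gauss by (auto simp only: gauss_word_def set_append list.set Un_iff insert_iff)
  note count = this
  have "A \<noteq> B" using count(1) by (auto split: if_splits)
  moreover have "A \<noteq> C" using count(1) by (auto split: if_splits)
  moreover have "B \<noteq> C" using count(2) by (auto split: if_splits)
  ultimately have dist: "distinct [A, B, C]" by simp
  have "count_list (x @ y @ z @ t) A = 0" "count_list (x @ y @ z @ t) B = 0"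
    "count_list (x @ y @ z @ t) C = 0"
    using count dist by auto
  then have A: "A \<notin> set x" "A \<notin> set y" "A \<notin> set z" "A \<notin> set t"
    and B: "B \<notin> set x" "B \<notin> set y" "B \<notin> set z" "B \<notin> set t"
    and C: "C \<notin> set x" "C \<notin> set y" "C \<notin> set z" "C \<notin> set t"
    unfolding count_list_0_iff by auto
  have expand: "v4 w = (\<Sum>T\<in>Pow ?R.
      pattern_parity (w \<downharpoonright> T) + pattern_parity (w \<downharpoonright> insert A T)
      + pattern_parity (w \<downharpoonright> insert B T) + pattern_parity (w \<downharpoonright> insert C T)
      + (pattern_parity (w \<downharpoonright> insert A (insert B T)) + pattern_parity (w \<downharpoonright> insert A (insert C T))
        + pattern_parity (w \<downharpoonright> insert B (insert C T))
        + pattern_parity (w \<downharpoonright> insert A (insert B (insert C T)))))"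
    if "set w = insert A (insert B (insert C ?R))" for w
    unfolding v4_eq_sum that using dist A B C by (intro sum_Pow_insert3) auto
  have set_l: "set ?l = insert A (insert B (insert C ?R))"
    and set_r: "set ?r = insert A (insert B (insert C ?R))"
    by auto
  show ?thesis
    unfolding expand[OF set_l] expand[OF set_r]
  proof (rule sum.cong[OF refl], rule arg_cong2[where f = "(+)"])
    fix T assume "T \<in> Pow ?R"
    then have T: "A \<notin> T" "B \<notin> T" "C \<notin> T" using A B C by auto
    let ?x = "x \<downharpoonright> T" and ?y = "y \<downharpoonright> T" and ?z = "z \<downharpoonright> T" and ?t = "t \<downharpoonright> T"
    have "?l \<downharpoonright> T = ?r \<downharpoonright> T" "?l \<downharpoonright> insert A T = ?r \<downharpoonright> insert A T"
      "?l \<downharpoonright> insert B T = ?r \<downharpoonright> insert B T" "?l \<downharpoonright> insert C T = ?r \<downharpoonright> insert C T"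
      using dist T by auto
    then show "pattern_parity (?l \<downharpoonright> T) + pattern_parity (?l \<downharpoonright> insert A T)
        + pattern_parity (?l \<downharpoonright> insert B T) + pattern_parity (?l \<downharpoonright> insert C T) =
      pattern_parity (?r \<downharpoonright> T) + pattern_parity (?r \<downharpoonright> insert A T)
        + pattern_parity (?r \<downharpoonright> insert B T) + pattern_parity (?r \<downharpoonright> insert C T)"
      by (simp only:)
    have restrict:
      "?l \<downharpoonright> insert A (insert B T) = ?x @ [A, B] @ ?y @ [A] @ ?z @ [B] @ ?t"
      "?r \<downharpoonright> insert A (insert B T) = ?x @ [B, A] @ ?y @ [A] @ ?z @ [B] @ ?t"
      "?l \<downharpoonright> insert A (insert C T) = ?x @ [A] @ ?y @ [A, C] @ ?z @ [C] @ ?t"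
      "?r \<downharpoonright> insert A (insert C T) = ?x @ [A] @ ?y @ [C, A] @ ?z @ [C] @ ?t"
      "?l \<downharpoonright> insert B (insert C T) = ?x @ [B] @ ?y @ [C] @ ?z @ [B, C] @ ?t"
      "?r \<downharpoonright> insert B (insert C T) = ?x @ [B] @ ?y @ [C] @ ?z @ [C, B] @ ?t"
      "?l \<downharpoonright> insert A (insert B (insert C T)) = ?x @ [A, B] @ ?y @ [A, C] @ ?z @ [B, C] @ ?t"
      "?r \<downharpoonright> insert A (insert B (insert C T)) = ?x @ [B, A] @ ?y @ [C, A] @ ?z @ [C, B] @ ?t"
      using dist A B C T by (auto intro!: filter_cong)
    have "gauss_word (filter (\<lambda>D. D \<in> T) ?l)" using gauss by (rule gauss_word_filter)
    then have "gauss_word (?x @ ?y @ ?z @ ?t)" using T by simp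
    then have "(\<Sum>w\<leftarrow>move3_subwords A B C ?x ?y ?z ?t. pattern_parity w) = 0"
      using dist T by (intro sum_pattern_parity_move3_subwords) auto
    then have sum0: "(pattern_parity (?l \<downharpoonright> insert A (insert B T))
        + pattern_parity (?l \<downharpoonright> insert A (insert C T)) + pattern_parity (?l \<downharpoonright> insert B (insert C T))
        + pattern_parity (?l \<downharpoonright> insert A (insert B (insert C T))))
      + (pattern_parity (?r \<downharpoonright> insert A (insert B T))
        + pattern_parity (?r \<downharpoonright> insert A (insert C T)) + pattern_parity (?r \<downharpoonright> insert B (insert C T))
        + pattern_parity (?r \<downharpoonright> insert A (insert B (insert C T)))) = 0"
      unfolding restrict move3_subwords_def list.map sum_list.Cons sum_list.Nil
      by (simp only: ac_simps add_0_right add_0_left)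
    \<comment> \<open>Modulo 2, a vanishing total of both sides means that the two sides agree.\<close>
    have eqI: "a = b" if "a + b = 0" for a b :: bit using that by (cases a; cases b) auto
    show "pattern_parity (?l \<downharpoonright> insert A (insert B T))
        + pattern_parity (?l \<downharpoonright> insert A (insert C T)) + pattern_parity (?l \<downharpoonright> insert B (insert C T))
        + pattern_parity (?l \<downharpoonright> insert A (insert B (insert C T))) =
      pattern_parity (?r \<downharpoonright> insert A (insert B T))
        + pattern_parity (?r \<downharpoonright> insert A (insert C T)) + pattern_parity (?r \<downharpoonright> insert B (insert C T))
        + pattern_parity (?r \<downharpoonright> insert A (insert B (insert C T)))"
      using sum0 by (rule eqI)
  qed
qed

section \<open>Homotopy invariance and degree\<close>

lemma homotopy_step_v4: "homotopy_step u w \<Longrightarrow> v4 u = v4 w"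
  by (induction rule: homotopy_step.induct) (rule v4_gauss_iso v4_move1 v4_move2 v4_move3; assumption)+

lemma homotopy_invariant_v4: "homotopy_invariant v4"
  unfolding homotopy_invariant_def homotopic_def
proof (intro allI impI, elim conjE)
  fix u w :: "'a list"
  assume "equivclp homotopy_step u w"
  then show "v4 u = v4 w"
    by (induction rule: equivclp_induct) (auto dest: homotopy_step_v4)
qed

text \<open>
  A bound below four would be violated by the copy of \<open>w\<^sub>1\<close>, so the least bound is four.
\<close>

theorem proposition8p3:
  shows "finite_type_invariant (v4 :: 'a::infinite list \<Rightarrow> bit)
    \<and> finite_type_degree (v4 :: 'a::infinite list \<Rightarrow> bit) = 4"
proof
  show "finite_type_invariant (v4 :: 'a list \<Rightarrow> bit)"
    using homotopy_invariant_v4 vanishes_above_v4 by (auto simp: finite_type_invariant_def)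
  show "finite_type_degree (v4 :: 'a list \<Rightarrow> bit) = 4"
    unfolding finite_type_degree_def
    using vanishes_above_v4 not_vanishes_above_v4 by (intro Least_equality) (auto simp: not_less[symmetric])
qed

end
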